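(* For $x\ge0$ let $q(x)=x^2/2+\tfrac12\log(2\pi)-\log Y(x)$ (so $q$ is an increasing bijection $[0,\infty)\to[\log2,\infty)$), and extend $q^{-1}$ by $q^{-1}(y)=-\infty$ for $y\le0$ if needed. Let $n\ge1$, $0<\hat\theta<1$ with $n\hat\theta$ an integer, and $\log 2<\alpha\le n\hat\theta^2(1-\hat\theta)^2/8$. Write $r=\sqrt{n\hat\theta(1-\hat\theta)}$. Then there is a solution $\gamma_\alpha$ of $-\log P_{\mathrm{X},n}\big(\hat\theta\,\big|\,\varphi(\gamma_\alpha,\hat\theta)\big)=\alpha$ satisfying $$\gamma_\alpha\in\max\!\left(0,\,q^{-1}\!\left(\alpha\Big(1+\tfrac{64\sqrt\alpha/(15\sqrt{15})}{r}[-1,1]\Big)+\tfrac{\sqrt{\pi/6}+8\sqrt\alpha/\sqrt{15}}{r}[-1,1]\right)\right)\times\left(1+\tfrac{2\sqrt\alpha/\sqrt5}{r}[-1,1]\right),$$ where interval expressions are evaluated monotonically: the lower (resp. upper) bound on $\gamma_\alpha$ is obtained by taking all lower (resp. upper) endpoints of the intervals $[-1,1]$.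
   Context: Logarithms are natural. $Y(x)=e^{x^2/2}\int_x^\infty e^{-s^2/2}\,ds$. $P_{\mathrm{X},n}(t|\varphi)=\sum_{k\ge nt}\binom{n}{k}\varphi^k(1-\varphi)^{n-k}$. With $\hat\sigma=\sqrt{\hat\theta(1-\hat\theta)/n}$, $\varphi(\gamma,\hat\theta)=\hat\theta-\hat\sigma\gamma$. *)

theory Defs
  imports "HOL-Analysis.Analysis"
begin

definition Yfun :: "real \<Rightarrow> real" where
  "Yfun x = exp (x\<^sup>2 / 2) * (LBINT s:{x..}. exp (- (s\<^sup>2) / 2))"

definition PX :: "nat \<Rightarrow> real \<Rightarrow> real \<Rightarrow> real" where
  "PX n t \<phi> = (\<Sum>k\<in>{k. k \<le> n \<and> real n * t \<le> real k}.
                  real (n choose k) * \<phi> ^ k * (1 - \<phi>) ^ (n - k))"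

definition sigma_hat :: "nat \<Rightarrow> real \<Rightarrow> real" where
  "sigma_hat n \<theta> = sqrt (\<theta> * (1 - \<theta>) / real n)"

definition phi :: "nat \<Rightarrow> real \<Rightarrow> real \<Rightarrow> real" where
  "phi n \<gamma> \<theta> = \<theta> - sigma_hat n \<theta> * \<gamma>"

definition qfun :: "real \<Rightarrow> real" where
  "qfun x = x\<^sup>2 / 2 + ln (2 * pi) / 2 - ln (Yfun x)"

text \<open>Inverse of q restricted to [0,\<infinity>) (meaningful for y \<ge> log 2).\<close>
definition qinv :: "real \<Rightarrow> real" where
  "qinv y = (THE x. 0 \<le> x \<and> qfun x = y)"

text \<open>max(0, q^{-1}(y)) with q^{-1} extended monotonically below log 2
  (q^{-1}(y) \<le> 0 there, -\<infinity> for y \<le> 0).\<close>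
definition max0_qinv :: "real \<Rightarrow> real" where
  "max0_qinv y = (if y \<le> ln 2 then 0 else qinv y)"

end

(*
  The tail P(u) of Bin(n,u) at m = n theta has derivative proportional to exp(- n kl(theta,u)) / u,
  kl being the relative entropy.  In the coordinate w(u) = sqrt(2 n kl(theta,u)) this is a Gaussian
  density times a factor h with 1 <= h <= 1 + w/r for u < theta (reflected for u > theta).
  Comparing derivatives, with T the Gaussian tail and L = P(Bin(n,theta) = m),
    L r T(w) <= P <= L r T(w) + L exp(- w^2/2)        on (0,theta],
    L r T(w) - L exp(- w^2/2) <= 1 - P <= L r T(w)    on [theta,1).
  At u = theta the four bounds give P >= 1/2 and L r sqrt(2 pi) = 1 + O(1/r), so no Stirling
  formula is needed.  Taking logarithms, q(w) = alpha + O((w+1)/r).  Finally gamma and w are compared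
  by bounding the second derivative 1/(u(1-u)) of the entropy between the solution and theta.
*)
theory Submission
  imports Defs "HOL-Probability.Probability" "HOL-Real_Asymp.Real_Asymp"
begin

subsection \<open>The Gaussian tail\<close>

text \<open>The coordinate w is the square root of a function vanishing quadratically at theta, so
  it has a corner there. The comparisons therefore start from the far ends 0 and 1, where P,
  respectively 1 - P, and all Gaussian terms vanish; theta is reached only by continuity. The term L
  exp(- w^2/2) accounts for the excess w/r in h, since w exp(- w^2/2) has the primitive - exp(-
  w^2/2). A Mills ratio bound turns this additive error into a relative one, which permits taking
  logarithms. Errors in w must end as errors in sqrt alpha. This needs P <= exp(- n kl) with
  constant exactly 1, giving w^2 <= 2 alpha; it is read off the same comparison once r >= 4. The
  lower bound log 2 on alpha puts a solution at u <= theta, because P(theta) >= 1/2, and keeps sqrt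
  alpha above 4/5, so that multiples of sqrt alpha absorb absolute constants. The upper bound on
  alpha forces r >= 4 and, with Pinsker's inequality, |u - theta| <= theta(1 - theta)/4, so that the
  variance u(1 - u) changes by at most a quarter of its value at theta.\<close>

definition gauss_tail :: "real \<Rightarrow> real" where
  "gauss_tail x = (LBINT s:{x..}. exp (- (s\<^sup>2) / 2))"

lemma integrable_gauss: "integrable lborel (\<lambda>s::real. exp (- (s\<^sup>2) / 2))"
proof -
  have "integrable lborel (\<lambda>s. sqrt (2 * pi) * std_normal_density s)"
    using integrable_std_normal_moment[of 0] by simp
  then show ?thesis
    by (simp add: std_normal_density_def)
qed

lemma set_integrable_gauss: "A \<in> sets borel \<Longrightarrow> set_integrable lborel A (\<lambda>s::real. exp (- (s\<^sup>2) / 2))"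
  unfolding set_integrable_def using integrable_mult_indicator[OF _ integrable_gauss, of A] by simp

lemma gauss_tail_0: "gauss_tail 0 = sqrt (pi / 2)"
proof -
  let ?f = "\<lambda>x::real. indicator {0..} x *\<^sub>R exp (- x\<^sup>2)"
  have "integral\<^sup>L lborel ?f = \<bar>1 / sqrt 2\<bar> *\<^sub>R (\<integral>x. ?f (0 + 1 / sqrt 2 * x) \<partial>lborel)"
    by (rule lborel_integral_real_affine) simp
  also have "(\<lambda>x. ?f (0 + 1 / sqrt 2 * x)) = (\<lambda>s. indicator {0..} s *\<^sub>R exp (- (s\<^sup>2) / 2))"
    by (auto simp: fun_eq_iff indicator_def power_divide zero_le_divide_iff)
  finally have "sqrt pi / 2 = (1 / sqrt 2) * gauss_tail 0"
    using has_bochner_integral_integral_eq[OF gaussian_moment_0]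
    by (simp add: gauss_tail_def set_lebesgue_integral_def)
  then have "gauss_tail 0 = sqrt pi / 2 * sqrt 2"
    by (simp add: field_simps)
  also have "\<dots> = sqrt (pi / 2)"
    by (simp add: real_sqrt_divide field_simps)
  finally show ?thesis .
qed

lemma gauss_tail_split:
  assumes "a \<le> b"
  shows "gauss_tail a = integral {a..b} (\<lambda>s. exp (- (s\<^sup>2) / 2)) + gauss_tail b"
proof -
  have "{a..} = {a..b} \<union> {b..}" using assms by auto
  moreover have "AE x in lborel. \<not> (x \<in> {a..b} \<and> x \<in> {b..})"
    using AE_lborel_singleton[of b] by eventually_elim auto
  ultimately have "gauss_tail a = (LBINT s:{a..b}. exp (- (s\<^sup>2) / 2)) + gauss_tail b"
    unfolding gauss_tail_def
    by (simp only:) (intro set_integral_Un_AE set_integrable_gauss, auto)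
  also have "(LBINT s:{a..b}. exp (- (s\<^sup>2) / 2)) = integral {a..b} (\<lambda>s. exp (- (s\<^sup>2) / 2))"
    by (intro set_borel_integral_eq_integral set_integrable_gauss) simp
  finally show ?thesis .
qed

lemma gauss_tail_deriv [derivative_intros]:
  assumes "(f has_real_derivative f') (at x within S)"
  shows "((\<lambda>x. gauss_tail (f x)) has_real_derivative - exp (- ((f x)\<^sup>2) / 2) * f') (at x within S)"
proof -
  have *: "(gauss_tail has_real_derivative - exp (- (z\<^sup>2) / 2)) (at z)" for z
  proof -
    let ?g = "\<lambda>s::real. exp (- (s\<^sup>2) / 2)"
    \<comment> \<open>Near \<open>z\<close> the tail is a constant minus a proper integral from
      \<open>z-1\<close>, so the fundamental theorem on a compact interval applies.\<close>
    have "((\<lambda>y. integral {z-1..y} ?g) has_real_derivative ?g z) (at z within {z-1..z+1})"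
      by (rule integral_has_real_derivative) (auto intro!: continuous_intros)
    then have "((\<lambda>y. gauss_tail (z-1) - integral {z-1..y} ?g) has_real_derivative - ?g z) (at z)"
      by (auto intro!: derivative_eq_intros simp: at_within_Icc_at)
    then show ?thesis
    proof (rule DERIV_cong_ev[THEN iffD1, rotated -1])
      have "eventually (\<lambda>y. y > z - 1) (nhds z)"
        by (intro order_tendstoD(1)[OF filterlim_ident]) simp_all
      then show "eventually (\<lambda>y. gauss_tail (z-1) - integral {z-1..y} ?g = gauss_tail y) (nhds z)"
      proof eventually_elim
        case (elim y)
        then show ?case using gauss_tail_split[of "z-1" y] by simp
      qed
    qed simp_all
  qed
  show ?thesis using DERIV_chain2[OF * assms] .
qed

lemma gauss_tail_tendsto_0: "(gauss_tail \<longlongrightarrow> 0) at_top"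
proof -
  let ?f = "\<lambda>s::real. exp (- (s\<^sup>2) / 2)"
  have "((\<lambda>y. \<integral>s. indicator {..y} s *\<^sub>R ?f s \<partial>lborel) \<longlongrightarrow> (\<integral>s. ?f s \<partial>lborel)) at_top"
    by (rule tendsto_integral_at_top) (use integrable_gauss in auto)
  from tendsto_diff[OF tendsto_const this, of "\<integral>s. ?f s \<partial>lborel"]
  have "((\<lambda>y. (\<integral>s. ?f s \<partial>lborel) - (LBINT s:{..y}. ?f s)) \<longlongrightarrow> 0) at_top"
    by (simp add: set_lebesgue_integral_def)
  moreover have "(\<integral>s. ?f s \<partial>lborel) - (LBINT s:{..y}. ?f s) = gauss_tail y" for y
  proof -
    have "AE x in lborel. \<not> (x \<in> {..y} \<and> x \<in> {y..})"
      using AE_lborel_singleton[of y] by eventually_elim auto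
    then have "(LBINT s:{..y} \<union> {y..}. ?f s) = (LBINT s:{..y}. ?f s) + gauss_tail y"
      unfolding gauss_tail_def by (intro set_integral_Un_AE set_integrable_gauss) auto
    moreover have "{..y} \<union> {y..} = UNIV" by auto
    ultimately show ?thesis by (simp add: set_lebesgue_integral_def)
  qed
  ultimately show ?thesis by simp
qed

lemma gauss_tail_strict_antimono: "x < y \<Longrightarrow> gauss_tail y < gauss_tail x"
  by (rule DERIV_neg_imp_decreasing) (auto intro!: derivative_eq_intros)

lemma gauss_tail_pos: "0 < gauss_tail x"
  by (rule DERIV_neg_imp_decreasing_at_top[where b = x])
     (auto intro!: derivative_eq_intros exI gauss_tail_tendsto_0)

text \<open>After shifting the variable by \<open>w\<close>, use (w + s)^2 >= w^2 + s^2 for s >= 0;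
  the constant is the tail at 0.\<close>

lemma gauss_tail_le_exp:
  assumes "0 \<le> w"
  shows "gauss_tail w \<le> sqrt (pi / 2) * exp (- (w\<^sup>2) / 2)"
proof -
  let ?h = "\<lambda>s::real. exp (- (s\<^sup>2) / 2)"
  have i: "integrable lborel (\<lambda>s. indicator A s *\<^sub>R ?h s)" if "A \<in> sets borel" for A
    using set_integrable_gauss[OF that] by (simp add: set_integrable_def)
  have "gauss_tail w = (\<integral>s. indicator {w..} (w + 1 * s) *\<^sub>R ?h (w + 1 * s) \<partial>lborel)"
    unfolding gauss_tail_def set_lebesgue_integral_def
    by (subst lborel_integral_real_affine[where c=1 and t=w]) auto
  also have "\<dots> \<le> (\<integral>s. exp (- (w\<^sup>2) / 2) * (indicator {0..} s *\<^sub>R ?h s) \<partial>lborel)"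
  proof (rule integral_mono)
    show "integrable lborel (\<lambda>s. indicator {w..} (w + 1 * s) *\<^sub>R ?h (w + 1 * s))"
      using lborel_integrable_real_affine[OF i[of "{w..}"], of 1 w] by simp
    show "integrable lborel (\<lambda>s. exp (- (w\<^sup>2) / 2) * (indicator {0..} s *\<^sub>R ?h s))"
      using i[of "{0..}"] by simp
    fix s
    show "indicator {w..} (w + 1 * s) *\<^sub>R ?h (w + 1 * s) \<le> exp (- (w\<^sup>2) / 2) * (indicator {0..} s *\<^sub>R ?h s)"
    proof (cases "0 \<le> s")
      case True
      then have "w\<^sup>2 + s\<^sup>2 \<le> (w + s)\<^sup>2"
        using assms by (simp add: power2_sum)
      then show ?thesis
        using True by (simp add: mult_exp_exp)
    qed simp
  qed
  also have "\<dots> = exp (- (w\<^sup>2) / 2) * gauss_tail 0"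
    by (simp add: gauss_tail_def set_lebesgue_integral_def)
  finally show ?thesis by (simp add: gauss_tail_0 mult.commute)
qed

text \<open>The difference \<open>?F\<close> of the tail and exp (- x^2 / 2) / (x + 1) is
  nonincreasing, because z^2 + z + 1 <= (z + 1)^2, and tends to 0 at infinity. A weak lower bound on
  the Mills ratio, but valid down to x = 0.\<close>

lemma gauss_tail_mills:
  assumes "0 \<le> x"
  shows "exp (- (x\<^sup>2) / 2) \<le> (x + 1) * gauss_tail x"
proof -
  let ?F = "\<lambda>x. gauss_tail x - exp (- (x\<^sup>2) / 2) / (x + 1)"
  let ?D = "\<lambda>x. - exp (- (x\<^sup>2) / 2) * (1 - (x\<^sup>2 + x + 1) / (x + 1)\<^sup>2)"
  have d: "(?F has_real_derivative ?D z) (at z)" if "0 \<le> z" for z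
  proof -
    have "z + 1 \<noteq> 0" using that by simp
    then show ?thesis
      by (auto intro!: derivative_eq_intros) (simp add: divide_simps, simp add: algebra_simps power2_eq_square)
  qed
  have neg: "?D z \<le> 0" if "0 \<le> z" for z :: real
  proof -
    have "z\<^sup>2 + z + 1 \<le> (z + 1)\<^sup>2" "0 < (z + 1)\<^sup>2"
      using that by (simp_all add: power2_eq_square algebra_simps add_pos_nonneg)
    then show ?thesis by (simp add: mult_nonpos_nonneg)
  qed
  have anti: "?F y \<le> ?F x" if "x \<le> y" for y
    by (rule DERIV_nonpos_imp_nonincreasing[OF that]) (use d neg assms in \<open>meson order.trans\<close>)
  have "(?F \<longlongrightarrow> 0 - 0) at_top"
    by (intro tendsto_diff gauss_tail_tendsto_0) real_asymp
  then have "0 \<le> ?F x"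
    by (intro tendsto_upperbound[where f = ?F and F = at_top])
       (auto intro!: eventually_mono[OF eventually_ge_at_top[of x]] dest: anti)
  then show ?thesis
    using assms by (simp add: divide_le_eq mult.commute)
qed

subsection \<open>The quantile function q\<close>

text \<open>The factor exp (x^2 / 2) in \<open>Yfun\<close> cancels x^2 / 2, so q is minus the
  logarithm of the normalised Gaussian tail.\<close>

lemma qfun_eq: "qfun x = ln (2 * pi) / 2 - ln (gauss_tail x)"
  using gauss_tail_pos[of x]
  unfolding qfun_def Yfun_def gauss_tail_def[symmetric] by (simp add: ln_mult_pos)

lemma qfun_0: "qfun 0 = ln 2"
proof -
  have "ln (sqrt (pi / 2)) = (ln pi - ln 2) / 2"
    by (simp add: ln_sqrt ln_div)
  then show ?thesis
    by (simp add: qfun_eq gauss_tail_0 ln_mult_pos field_simps)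
qed

lemma qfun_strict_mono: "strict_mono qfun"
  by (rule strict_monoI) (simp add: qfun_eq gauss_tail_strict_antimono gauss_tail_pos)

lemma max0_qinv:
  assumes "ln 2 < y"
  shows "0 \<le> max0_qinv y" "qfun (max0_qinv y) = y"
proof -
  have "filterlim qfun at_top at_top"
  proof -
    have "filterlim gauss_tail (at_right 0) at_top"
      using gauss_tail_tendsto_0 by (simp add: filterlim_at gauss_tail_pos less_imp_neq[symmetric])
    then have "filterlim (\<lambda>x. ln (gauss_tail x)) at_bot at_top"
      by (rule filterlim_compose[OF ln_at_0])
    then have "filterlim (\<lambda>x. ln (2 * pi) / 2 + - ln (gauss_tail x)) at_top at_top"
      by (intro filterlim_tendsto_add_at_top[OF tendsto_const]) (simp add: filterlim_uminus_at_top)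
    then show ?thesis by (simp add: qfun_eq[abs_def])
  qed
  then have "eventually (\<lambda>x. y \<le> qfun x) at_top"
    by (simp add: filterlim_at_top)
  then obtain b where b: "0 \<le> b" "y \<le> qfun b"
    using eventually_happens[OF eventually_conj[OF eventually_ge_at_top[of 0]]] by fastforce
  have "isCont qfun z" for z
    unfolding qfun_eq[abs_def] using gauss_tail_pos[of z]
    by (intro DERIV_isCont) (auto intro!: derivative_eq_intros)
  then have "\<exists>x\<ge>0. x \<le> b \<and> qfun x = y"
    using b assms by (intro IVT) (auto simp: qfun_0)
  then obtain x where x: "0 \<le> x" "qfun x = y" by auto
  \<comment> \<open>Strict monotonicity gives the uniqueness that the definite description in
    \<open>qinv\<close> requires.\<close>
  have "qinv y = x"
    unfolding qinv_def using x strict_mono_eq[OF qfun_strict_mono] by blast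
  then show "0 \<le> max0_qinv y" "qfun (max0_qinv y) = y"
    using x assms by (auto simp: max0_qinv_def)
qed

subsection \<open>Relative entropy of Bernoulli laws\<close>

definition kl :: "real \<Rightarrow> real \<Rightarrow> real" where
  "kl t u = t * ln (t / u) + (1 - t) * ln ((1 - t) / (1 - u))"

lemma kl_self [simp]: "kl t t = 0"
  by (simp add: kl_def)

lemma kl_deriv [derivative_intros]:
  assumes "0 < t" "t < 1" "0 < u" "u < 1"
  shows "(kl t has_real_derivative (u - t) / (u * (1 - u))) (at u)"
proof -
  have deriv: "((\<lambda>u. t * (ln t - ln u) + (1 - t) * (ln (1 - t) - ln (1 - u)))
          has_real_derivative (u - t) / (u * (1 - u))) (at u)"
    using assms by (auto intro!: derivative_eq_intros) (simp add: divide_simps, simp add: algebra_simps)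
  have "eventually (\<lambda>u. 0 < u \<and> u < 1) (nhds u)"
    using assms by (intro eventually_conj order_tendstoD[OF filterlim_ident]) auto
  then have "eventually (\<lambda>u. t * (ln t - ln u) + (1 - t) * (ln (1 - t) - ln (1 - u)) = kl t u) (nhds u)"
    by eventually_elim (use assms in \<open>simp add: kl_def ln_div\<close>)
  from DERIV_cong_ev[OF refl this refl] deriv show ?thesis
    by (rule iffD1)
qed

text \<open>F increases up to t and decreases after it. The explicit factor u - t in the derivative
  lets one statement serve points p on either side of t.\<close>

lemma nonpos_if_maximal_at:
  fixes F :: "real \<Rightarrow> real"
  assumes F0: "F t = 0"
    and F: "\<And>u. u \<in> closed_segment p t \<Longrightarrow> (F has_real_derivative (u - t) * h u) (at u)"
    and h: "\<And>u. u \<in> closed_segment p t \<Longrightarrow> h u \<le> 0"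
  shows "F p \<le> 0"
proof (cases "p \<le> t")
  case True
  have "F p \<le> F t"
  proof (rule DERIV_nonneg_imp_nondecreasing[OF True])
    fix u assume "p \<le> u" "u \<le> t"
    then have "u \<in> closed_segment p t" by (simp add: closed_segment_eq_real_ivl)
    from F[OF this] mult_nonpos_nonpos[OF _ h[OF this], of "u - t"] \<open>u \<le> t\<close>
    show "\<exists>y. (F has_real_derivative y) (at u) \<and> 0 \<le> y" by auto
  qed
  then show ?thesis using F0 by simp
next
  case False
  then have "t \<le> p" by simp
  have "F p \<le> F t"
  proof (rule DERIV_nonpos_imp_nonincreasing[OF \<open>t \<le> p\<close>])
    fix u assume "t \<le> u" "u \<le> p"
    then have "u \<in> closed_segment p t" by (auto simp: closed_segment_eq_real_ivl)
    from F[OF this] mult_nonneg_nonpos[OF _ h[OF this], of "u - t"] \<open>t \<le> u\<close>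
    show "\<exists>y. (F has_real_derivative y) (at u) \<and> y \<le> 0" by auto
  qed
  then show ?thesis using F0 by simp
qed

context
  fixes t p :: real and E g :: "real \<Rightarrow> real"
  assumes tp: "0 < t" "t < 1" "0 < p" "p < 1"
    and E0: "E t = 0"
    and E: "\<And>u. u \<in> closed_segment p t \<Longrightarrow> (E has_real_derivative (u - t) * g u) (at u)"
begin

lemma segment_unit: "u \<in> closed_segment p t \<Longrightarrow> 0 < u \<and> u < 1"
  using tp by (auto simp: closed_segment_eq_real_ivl split: if_splits)

text \<open>The derivative of \<open>kl t\<close> is (u - t) / (u * (1 - u)), so a comparison
  function with derivative (u - t) * g u is compared with \<open>kl\<close> through the sign-free
  condition on u * (1 - u) * g u alone.\<close>

lemma le_kl_if:
  assumes "\<And>u. u \<in> closed_segment p t \<Longrightarrow> u * (1 - u) * g u \<le> 1"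
  shows "E p \<le> kl t p"
proof -
  have "E p - kl t p \<le> 0"
  proof (rule nonpos_if_maximal_at[where F = "\<lambda>u. E u - kl t u" and t = t and p = p and h = "\<lambda>u. g u - 1 / (u * (1 - u))"])
    fix u assume u: "u \<in> closed_segment p t"
    note b = segment_unit[OF u]
    have "((\<lambda>u. E u - kl t u) has_real_derivative (u - t) * g u - (u - t) / (u * (1 - u))) (at u)"
      by (intro DERIV_diff E[OF u] kl_deriv) (use tp b in auto)
    then show "((\<lambda>u. E u - kl t u) has_real_derivative (u - t) * (g u - 1 / (u * (1 - u)))) (at u)"
      by (simp add: right_diff_distrib)
    show "g u - 1 / (u * (1 - u)) \<le> 0"
      using assms[OF u] b by (simp add: pos_le_divide_eq mult.commute)
  qed (simp add: E0)
  then show ?thesis by simp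
qed

lemma kl_le_if:
  assumes "\<And>u. u \<in> closed_segment p t \<Longrightarrow> 1 \<le> u * (1 - u) * g u"
  shows "kl t p \<le> E p"
proof -
  have "kl t p - E p \<le> 0"
  proof (rule nonpos_if_maximal_at[where F = "\<lambda>u. kl t u - E u" and t = t and p = p and h = "\<lambda>u. 1 / (u * (1 - u)) - g u"])
    fix u assume u: "u \<in> closed_segment p t"
    note b = segment_unit[OF u]
    have "((\<lambda>u. kl t u - E u) has_real_derivative (u - t) / (u * (1 - u)) - (u - t) * g u) (at u)"
      by (intro DERIV_diff E[OF u] kl_deriv) (use tp b in auto)
    then show "((\<lambda>u. kl t u - E u) has_real_derivative (u - t) * (1 / (u * (1 - u)) - g u)) (at u)"
      by (simp add: right_diff_distrib)
    show "1 / (u * (1 - u)) - g u \<le> 0"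
      using assms[OF u] b by (simp add: pos_divide_le_eq mult.commute)
  qed (simp add: E0)
  then show ?thesis by simp
qed

end

lemma quad_deriv: "((\<lambda>u. (t - u)\<^sup>2 / (2 * M)) has_real_derivative (u - t) * (1 / M)) (at u)" for t M :: real
proof -
  have "((\<lambda>u. (t - u)\<^sup>2 / (2 * M)) has_real_derivative 2 * (t - u) * (- 1) / (2 * M)) (at u)"
    by (intro DERIV_cdivide) (auto intro!: derivative_eq_intros)
  moreover have "2 * (t - u) * (- 1) / (2 * M) = (u - t) * (1 / M)"
    by (cases "M = 0") (simp_all add: divide_simps)
  ultimately show ?thesis by simp
qed

text \<open>Here \<open>g\<close> is the constant 1 / M. With M = 1/4 this yields Pinsker's
  inequality; with M close to t * (1 - t) it compares gamma with w.\<close>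

lemma kl_ge_quadratic:
  assumes "0 < t" "t < 1" "0 < p" "p < 1" "0 < M"
    and M: "\<And>u. u \<in> closed_segment p t \<Longrightarrow> u * (1 - u) \<le> M"
  shows "(t - p)\<^sup>2 / (2 * M) \<le> kl t p"
proof (rule le_kl_if[where E = "\<lambda>u. (t - u)\<^sup>2 / (2 * M)" and g = "\<lambda>_. 1 / M"])
  fix u assume "u \<in> closed_segment p t"
  from M[OF this] show "u * (1 - u) * (1 / M) \<le> 1"
    using \<open>0 < M\<close> by simp
  show "((\<lambda>u. (t - u)\<^sup>2 / (2 * M)) has_real_derivative (u - t) * (1 / M)) (at u)"
    by (rule quad_deriv)
qed (use assms(1-4) in simp_all)

lemma kl_le_quadratic:
  assumes "0 < t" "t < 1" "0 < p" "p < 1" "0 < M"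
    and M: "\<And>u. u \<in> closed_segment p t \<Longrightarrow> M \<le> u * (1 - u)"
  shows "kl t p \<le> (t - p)\<^sup>2 / (2 * M)"
proof (rule kl_le_if[where E = "\<lambda>u. (t - u)\<^sup>2 / (2 * M)" and g = "\<lambda>_. 1 / M"])
  fix u assume "u \<in> closed_segment p t"
  from M[OF this] show "1 \<le> u * (1 - u) * (1 / M)"
    using \<open>0 < M\<close> by simp
  show "((\<lambda>u. (t - u)\<^sup>2 / (2 * M)) has_real_derivative (u - t) * (1 / M)) (at u)"
    by (rule quad_deriv)
qed (use assms(1-4) in simp_all)

lemma kl_pinsker:
  assumes "0 < t" "t < 1" "0 < p" "p < 1"
  shows "2 * (t - p)\<^sup>2 \<le> kl t p"
proof -
  have "u * (1 - u) \<le> 1 / 4" for u :: real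
    using zero_le_power2[of "2 * u - 1"] by (simp add: power2_eq_square algebra_simps)
  then have "(t - p)\<^sup>2 / (2 * (1 / 4)) \<le> kl t p"
    by (intro kl_ge_quadratic assms) auto
  then show ?thesis by simp
qed

lemma kl_pos:
  assumes "0 < t" "t < 1" "0 < p" "p < 1" "p \<noteq> t"
  shows "0 < kl t p"
proof -
  have "0 < 2 * (t - p)\<^sup>2" using assms(5) by simp
  also have "\<dots> \<le> kl t p" by (rule kl_pinsker) (fact assms)+
  finally show ?thesis .
qed

lemma kl_nonneg:
  assumes "0 < t" "t < 1" "0 < p" "p < 1"
  shows "0 \<le> kl t p"
  using kl_pinsker[OF assms] zero_le_power2[of "t - p"] by linarith

text \<open>Multiplied by 2 n, this function is the square of r (t - u) / (t (1 - u)), see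
  \<open>ratio1_r\<close>. Comparing it with \<open>kl\<close> thus compares the factor h = t (1 -
  u) w / (r (t - u)) with 1.\<close>

lemma ratio1_deriv:
  fixes t u :: real
  assumes "0 < t" "u < 1"
  shows "((\<lambda>u. (1 - t) * ((t - u) / (1 - u))\<^sup>2 / (2 * t)) has_real_derivative
           (u - t) * ((1 - t)\<^sup>2 / (t * (1 - u) ^ 3))) (at u)"
proof -
  define D where "D = (- (1 - t)) / ((1 - u) * (1 - u))"
  have nz: "1 - u \<noteq> 0" using assms by auto
  have "((\<lambda>u. (t - u) / (1 - u)) has_real_derivative ((- 1) * (1 - u) - (t - u) * (- 1)) / ((1 - u) * (1 - u))) (at u)"
    by (intro DERIV_divide nz) (auto intro!: derivative_eq_intros)
  also have "((- 1) * (1 - u) - (t - u) * (- 1)) / ((1 - u) * (1 - u)) = D"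
    by (simp add: D_def)
  finally have "((\<lambda>u. (1 - t) * ((t - u) / (1 - u))\<^sup>2 / (2 * t)) has_real_derivative
      (1 - t) * (of_nat 2 * (D * ((t - u) / (1 - u)) ^ (2 - Suc 0))) / (2 * t)) (at u)"
    by (intro DERIV_cdivide DERIV_cmult DERIV_power)
  also have "(1 - t) * (of_nat 2 * (D * ((t - u) / (1 - u)) ^ (2 - Suc 0))) / (2 * t) =
      (1 - t) * (D * ((t - u) / (1 - u))) / t"
    by simp
  also have "\<dots> = (u - t) * ((1 - t)\<^sup>2 / (t * (1 - u) ^ 3))"
  proof -
    have "(a * (- a / (c * c) * (b / c))) / t = (- b) * (a\<^sup>2 / (t * c ^ 3))" for a b c :: real
      by (simp add: power2_eq_square power3_eq_cube mult_ac)
    from this[of "1 - t" "1 - u" "t - u"] show ?thesis by (simp only: D_def minus_diff_eq)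
  qed
  finally show ?thesis .
qed

text \<open>The image of \<open>ratio1_deriv\<close> under exchanging success and failure, t to 1 -
  t and u to 1 - u.\<close>

lemma ratio2_deriv:
  fixes t u :: real
  assumes "t < 1" "0 < u"
  shows "((\<lambda>u. t * ((t - u) / u)\<^sup>2 / (2 * (1 - t))) has_real_derivative
           (u - t) * (t\<^sup>2 / ((1 - t) * u ^ 3))) (at u)"
proof -
  have "((\<lambda>u. (1 - (1 - t)) * (((1 - t) - (1 - u)) / (1 - (1 - u)))\<^sup>2 / (2 * (1 - t))) has_real_derivative
      ((1 - u) - (1 - t)) * ((1 - (1 - t))\<^sup>2 / ((1 - t) * (1 - (1 - u)) ^ 3)) * (- 1)) (at u)"
    by (rule DERIV_chain2[OF ratio1_deriv[where t = "1 - t"]])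
       (use assms in \<open>auto intro!: derivative_eq_intros\<close>)
  moreover have "((u - t) / u)\<^sup>2 = ((t - u) / u)\<^sup>2" for u
    by (simp add: power_divide power2_commute)
  ultimately show ?thesis by (simp add: algebra_simps)
qed

lemma ratio_weight: "c \<noteq> 0 \<Longrightarrow> u * c * (a\<^sup>2 / (t * c ^ 3)) = (u / t) * (a / c)\<^sup>2" for t u c a :: real
  by (simp add: power_divide power2_eq_square power3_eq_cube)

text \<open>Both factors on the right are at most 1 for u <= t and at least 1 for u >= t. Hence the
  same function bounds \<open>kl\<close> from below on the left of t and from above on its right;
  for \<open>ratio2_weight\<close> the directions are swapped.\<close>

lemma ratio1_weight: "u < 1 \<Longrightarrow>
    u * (1 - u) * ((1 - t)\<^sup>2 / (t * (1 - u) ^ 3)) = (u / t) * ((1 - t) / (1 - u))\<^sup>2" for t u :: real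
  by (rule ratio_weight) simp

lemma ratio2_weight: "0 < u \<Longrightarrow>
    u * (1 - u) * (t\<^sup>2 / ((1 - t) * u ^ 3)) = ((1 - u) / (1 - t)) * (t / u)\<^sup>2" for t u :: real
  using ratio_weight[of u "1 - u" t "1 - t"] by (simp add: mult.commute)

lemma kl_ge_ratio1:
  assumes "0 < p" "p \<le> t" "t < 1"
  shows "(1 - t) * ((t - p) / (1 - p))\<^sup>2 / (2 * t) \<le> kl t p"
proof (rule le_kl_if[where E = "\<lambda>u. (1 - t) * ((t - u) / (1 - u))\<^sup>2 / (2 * t)"])
  fix u assume "u \<in> closed_segment p t"
  then have u: "0 < u" "u \<le> t" "u < 1" "0 < t"
    using assms by (auto simp: closed_segment_eq_real_ivl)
  have "(u / t) * ((1 - t) / (1 - u))\<^sup>2 \<le> 1 * 1"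
    using u assms by (intro mult_mono power_le_one) auto
  then show "u * (1 - u) * ((1 - t)\<^sup>2 / (t * (1 - u) ^ 3)) \<le> 1"
    using u assms by (subst ratio1_weight) auto
  show "((\<lambda>u. (1 - t) * ((t - u) / (1 - u))\<^sup>2 / (2 * t)) has_real_derivative
           (u - t) * ((1 - t)\<^sup>2 / (t * (1 - u) ^ 3))) (at u)"
    using u by (intro ratio1_deriv)
qed (use assms in auto)

lemma kl_le_ratio1:
  assumes "0 < t" "t \<le> p" "p < 1"
  shows "kl t p \<le> (1 - t) * ((t - p) / (1 - p))\<^sup>2 / (2 * t)"
proof (rule kl_le_if[where E = "\<lambda>u. (1 - t) * ((t - u) / (1 - u))\<^sup>2 / (2 * t)"])
  fix u assume "u \<in> closed_segment p t"
  then have u: "t \<le> u" "u < 1"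
    using assms by (auto simp: closed_segment_eq_real_ivl split: if_splits)
  have "1 * 1 \<le> (u / t) * ((1 - t) / (1 - u))\<^sup>2"
    using u assms by (intro mult_mono one_le_power) auto
  then show "1 \<le> u * (1 - u) * ((1 - t)\<^sup>2 / (t * (1 - u) ^ 3))"
    using u assms by (subst ratio1_weight) auto
  show "((\<lambda>u. (1 - t) * ((t - u) / (1 - u))\<^sup>2 / (2 * t)) has_real_derivative
           (u - t) * ((1 - t)\<^sup>2 / (t * (1 - u) ^ 3))) (at u)"
    using u assms by (intro ratio1_deriv)
qed (use assms in auto)

lemma kl_le_ratio2:
  assumes "0 < p" "p \<le> t" "t < 1"
  shows "kl t p \<le> t * ((t - p) / p)\<^sup>2 / (2 * (1 - t))"
proof (rule kl_le_if[where E = "\<lambda>u. t * ((t - u) / u)\<^sup>2 / (2 * (1 - t))"])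
  fix u assume "u \<in> closed_segment p t"
  then have u: "0 < u" "u \<le> t"
    using assms by (auto simp: closed_segment_eq_real_ivl)
  have "1 * 1 \<le> ((1 - u) / (1 - t)) * (t / u)\<^sup>2"
    using u assms by (intro mult_mono one_le_power) auto
  then show "1 \<le> u * (1 - u) * (t\<^sup>2 / ((1 - t) * u ^ 3))"
    using u assms by (subst ratio2_weight) auto
  show "((\<lambda>u. t * ((t - u) / u)\<^sup>2 / (2 * (1 - t))) has_real_derivative
           (u - t) * (t\<^sup>2 / ((1 - t) * u ^ 3))) (at u)"
    using u assms by (intro ratio2_deriv)
qed (use assms in auto)

lemma kl_ge_ratio2:
  assumes "0 < t" "t \<le> p" "p < 1"
  shows "t * ((t - p) / p)\<^sup>2 / (2 * (1 - t)) \<le> kl t p"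
proof (rule le_kl_if[where E = "\<lambda>u. t * ((t - u) / u)\<^sup>2 / (2 * (1 - t))"])
  fix u assume "u \<in> closed_segment p t"
  then have u: "t \<le> u" "u < 1" "0 < u" "t < 1"
    using assms by (auto simp: closed_segment_eq_real_ivl split: if_splits)
  have "((1 - u) / (1 - t)) * (t / u)\<^sup>2 \<le> 1 * 1"
    using u assms by (intro mult_mono power_le_one) auto
  then show "u * (1 - u) * (t\<^sup>2 / ((1 - t) * u ^ 3)) \<le> 1"
    using u assms by (subst ratio2_weight) auto
  show "((\<lambda>u. t * ((t - u) / u)\<^sup>2 / (2 * (1 - t))) has_real_derivative
           (u - t) * (t\<^sup>2 / ((1 - t) * u ^ 3))) (at u)"
    using u assms by (intro ratio2_deriv)
qed (use assms in auto)

lemma kl_at_right_0: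
  assumes "0 < t" "t < 1"
  shows "filterlim (kl t) at_top (at_right 0)"
proof -
  have "filterlim (\<lambda>u::real. inverse u) at_top (at_right 0)"
    by (rule filterlim_inverse_at_top_right)
  then have "filterlim (\<lambda>u::real. t * inverse u) at_top (at_right 0)"
    by (intro filterlim_tendsto_pos_mult_at_top[OF tendsto_const assms(1)])
  then have "filterlim (\<lambda>u. ln (t / u)) at_top (at_right 0)"
    by (intro filterlim_compose[OF ln_at_top]) (simp add: divide_inverse)
  then have "filterlim (\<lambda>u. t * ln (t / u)) at_top (at_right 0)"
    by (intro filterlim_tendsto_pos_mult_at_top[OF tendsto_const assms(1)])
  moreover have "((\<lambda>u. (1 - t) * ln ((1 - t) / (1 - u))) \<longlongrightarrow> (1 - t) * ln ((1 - t) / (1 - 0))) (at_right 0)"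
    using assms by (intro tendsto_intros) auto
  ultimately have "filterlim (\<lambda>u. (1 - t) * ln ((1 - t) / (1 - u)) + t * ln (t / u)) at_top (at_right 0)"
    by (intro filterlim_tendsto_add_at_top)
  then show ?thesis by (simp add: kl_def[abs_def] add.commute)
qed

lemma kl_reflect: "kl t u = kl (1 - t) (1 - u)"
  by (simp add: kl_def)

lemma kl_at_left_1:
  assumes "0 < t" "t < 1"
  shows "filterlim (kl t) at_top (at_left 1)"
proof -
  have "filterlim (\<lambda>u. 1 - u) (at_right 0) (at_left (1::real))"
    by (auto simp: filterlim_at eventually_at_filter intro!: tendsto_eq_intros)
  from filterlim_compose[OF kl_at_right_0[of "1 - t"] this] assms
  have "filterlim (\<lambda>u. kl (1 - t) (1 - u)) at_top (at_left 1)" by simp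
  then show ?thesis by (simp add: kl_reflect[symmetric])
qed

subsection \<open>Comparison of the binomial tail with the Gaussian tail\<close>

text \<open>Only a limit is required at a, since the value of \<open>kl t\<close> at 0 is an
  artefact of division by zero. The derivative is required only strictly below x, since x may be the
  corner t of w.\<close>

lemma nonneg_if_increasing_from_0:
  fixes F :: "real \<Rightarrow> real"
  assumes "a < x"
    and cont: "continuous_on {a<..x} F"
    and deriv: "\<And>u. a < u \<Longrightarrow> u < x \<Longrightarrow> \<exists>y. (F has_real_derivative y) (at u) \<and> 0 \<le> y"
    and lim: "(F \<longlongrightarrow> 0) (at_right a)"
  shows "0 \<le> F x"
proof (rule tendsto_upperbound[OF lim])
  have "F u \<le> F x" if "a < u" "u < x" for u
    by (rule DERIV_nonneg_imp_increasing_open)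
       (use that deriv in \<open>auto intro: continuous_on_subset[OF cont]\<close>)
  then show "eventually (\<lambda>u. F u \<le> F x) (at_right a)"
    using \<open>a < x\<close> by (auto simp: eventually_at_right)
qed simp

lemma nonneg_if_decreasing_to_0:
  fixes F :: "real \<Rightarrow> real"
  assumes "x < b"
    and cont: "continuous_on {x..<b} F"
    and deriv: "\<And>u. x < u \<Longrightarrow> u < b \<Longrightarrow> \<exists>y. (F has_real_derivative y) (at u) \<and> y \<le> 0"
    and lim: "(F \<longlongrightarrow> 0) (at_left b)"
  shows "0 \<le> F x"
proof (rule tendsto_upperbound[OF lim])
  have "F u \<le> F x" if "x < u" "u < b" for u
    by (rule DERIV_nonpos_imp_decreasing_open)
       (use that deriv in \<open>auto intro: continuous_on_subset[OF cont]\<close>)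
  then show "eventually (\<lambda>u. F u \<le> F x) (at_left b)"
    using \<open>x < b\<close> by (auto simp: eventually_at_left)
qed simp

text \<open>The sum telescopes: each term's derivative is a difference of two neighbouring
  expressions of the stated form. The induction runs downwards from m = n.\<close>

lemma binomial_tail_deriv:
  assumes "0 < m" "m \<le> n"
  shows "((\<lambda>u. \<Sum>k=m..n. real (n choose k) * u ^ k * (1 - u) ^ (n - k)) has_real_derivative
            real m * real (n choose m) * u ^ (m - 1) * (1 - u) ^ (n - m)) (at u)"
  using assms(2,1)
proof (induction m rule: inc_induct)
  case base
  then show ?case
    by (auto intro!: derivative_eq_intros)
next
  case (step m)
  let ?t = "\<lambda>k u. real (n choose k) * u ^ k * (1 - u) ^ (n - k)"
  have "(?t m has_real_derivative
      real (n choose m) * (real m * u ^ (m - 1)) * (1 - u) ^ (n - m)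
      - real (n choose m) * u ^ m * (real (n - m) * (1 - u) ^ (n - m - 1))) (at u)"
    by (auto intro!: derivative_eq_intros)
  then have "((\<lambda>u. ?t m u + (\<Sum>k=Suc m..n. ?t k u)) has_real_derivative
      (real (n choose m) * (real m * u ^ (m - 1)) * (1 - u) ^ (n - m)
      - real (n choose m) * u ^ m * (real (n - m) * (1 - u) ^ (n - m - 1)))
      + real (Suc m) * real (n choose Suc m) * u ^ (Suc m - 1) * (1 - u) ^ (n - Suc m)) (at u)"
    by (rule DERIV_add[OF _ step.IH]) simp
  also have "(\<lambda>u. ?t m u + (\<Sum>k=Suc m..n. ?t k u)) = (\<lambda>u. \<Sum>k=m..n. ?t k u)"
    using step.hyps by (simp add: sum.atLeast_Suc_atMost fun_eq_iff)
  also have "real (n choose m) * u ^ m * (real (n - m) * (1 - u) ^ (n - m - 1)) =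
      (real (n choose m) * real (n - m)) * u ^ m * (1 - u) ^ (n - m - 1)"
    by (simp only: mult_ac)
  also have "real (n choose m) * real (n - m) = real (Suc m) * real (n choose Suc m)"
    by (metis Suc_times_binomial_add binomial_absorb_comp binomial_absorption mult.commute of_nat_mult)
  finally show ?case by (simp add: mult_ac)
qed

locale binomial_tail =
  fixes n m :: nat
  assumes m_pos: "0 < m" and m_less: "m < n"
begin

definition t :: real where "t = real m / real n"
definition r :: real where "r = sqrt (real n * t * (1 - t))"
text \<open>Unsigned on both sides of \<open>t\<close>, so each side gets its own bounds.\<close>

definition w :: "real \<Rightarrow> real" where "w u = sqrt (2 * real n * kl t u)"
definition e :: "real \<Rightarrow> real" where "e u = exp (- real n * kl t u)"
definition L :: real where "L = real (n choose m) * t ^ m * (1 - t) ^ (n - m)"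
definition P :: "real \<Rightarrow> real" where
  "P u = (\<Sum>k=m..n. real (n choose k) * u ^ k * (1 - u) ^ (n - k))"

lemma t_bounds: "0 < t" "t < 1"
  using m_pos m_less by (auto simp: t_def)

lemma n_pos: "0 < real n" using m_less by simp

lemma nt: "real n * t = real m" "real (n - m) = real n * (1 - t)"
  using n_pos m_less by (auto simp: t_def field_simps of_nat_diff)

lemma r_pos: "0 < r"
  using t_bounds n_pos by (simp add: r_def)

lemma r_sq: "r\<^sup>2 = real n * t * (1 - t)"
  using t_bounds n_pos by (simp add: r_def)

lemma L_pos: "0 < L"
  using t_bounds m_less by (simp add: L_def)

lemma w_sq: "0 < u \<Longrightarrow> u < 1 \<Longrightarrow> (w u)\<^sup>2 = 2 * real n * kl t u"
  using kl_nonneg[of t u] t_bounds n_pos by (simp add: w_def)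

lemma w_pos: "0 < u \<Longrightarrow> u < 1 \<Longrightarrow> u \<noteq> t \<Longrightarrow> 0 < w u"
  using kl_pos[of t u] t_bounds n_pos by (simp add: w_def)

lemma w_nonneg: "0 < u \<Longrightarrow> u < 1 \<Longrightarrow> 0 \<le> w u"
  using kl_nonneg[of t u] t_bounds n_pos by (simp add: w_def)

lemma exp_w: "0 < u \<Longrightarrow> u < 1 \<Longrightarrow> exp (- ((w u)\<^sup>2) / 2) = e u"
  by (simp add: w_sq e_def)

lemma w_self: "w t = 0" "e t = 1"
  by (simp_all add: w_def e_def)

lemma le_w:
  assumes "0 < u" "u < 1" "x\<^sup>2 \<le> 2 * real n * kl t u"
  shows "x \<le> w u"
  using assms w_sq[of u] w_nonneg[of u] by (metis power2_le_imp_le)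

lemma w_le:
  assumes "0 < u" "u < 1" "2 * real n * kl t u \<le> x\<^sup>2" "0 \<le> x"
  shows "w u \<le> x"
  using assms w_sq[of u] by (metis power2_le_imp_le)

lemma ratio1_r: "2 * real n * ((1 - t) * ((t - u) / (1 - u))\<^sup>2 / (2 * t)) = (r * (t - u) / (t * (1 - u)))\<^sup>2"
proof -
  define X where "X = ((t - u) / (1 - u))\<^sup>2"
  have "(r * (t - u) / (t * (1 - u)))\<^sup>2 = r\<^sup>2 * X / t\<^sup>2"
    by (simp add: X_def power_mult_distrib power_divide)
  also have "\<dots> = 2 * real n * ((1 - t) * X / (2 * t))"
    unfolding r_sq using t_bounds by (simp add: power2_eq_square)
  finally show ?thesis by (simp only: X_def)
qed

lemma ratio2_r: "2 * real n * (t * ((t - u) / u)\<^sup>2 / (2 * (1 - t))) = (r * (t - u) / ((1 - t) * u))\<^sup>2"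
proof -
  define X where "X = ((t - u) / u)\<^sup>2"
  define s where "s = 1 - t"
  have "(r * (t - u) / (s * u))\<^sup>2 = r\<^sup>2 * X / s\<^sup>2"
    by (simp add: X_def power_mult_distrib power_divide)
  also have "\<dots> = 2 * real n * (t * X / (2 * s))"
    unfolding r_sq using t_bounds by (simp add: power2_eq_square s_def[symmetric])
  finally show ?thesis by (simp only: X_def s_def)
qed

text \<open>In terms of h = t (1 - u) w / (r (t - u)), these are 1 <= h and, because t (1 - u) = u
  (1 - t) + (t - u), also h <= 1 + w / r. Without division they remain valid at u = t.\<close>

lemma w_left:
  assumes "0 < u" "u \<le> t"
  shows "r * (t - u) \<le> t * (1 - u) * w u" "u * (1 - t) * w u \<le> r * (t - u)"
proof -
  have u: "u < 1" using assms t_bounds by simp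
  have "r * (t - u) / (t * (1 - u)) \<le> w u"
    using mult_left_mono[OF kl_ge_ratio1[OF assms t_bounds(2)], of "2 * real n"] assms u n_pos
    by (intro le_w) (simp_all add: ratio1_r[symmetric])
  then show "r * (t - u) \<le> t * (1 - u) * w u"
    using u t_bounds by (simp add: pos_divide_le_eq mult_ac)
  have "w u \<le> r * (t - u) / ((1 - t) * u)"
    using mult_left_mono[OF kl_le_ratio2[OF assms t_bounds(2)], of "2 * real n"] assms u n_pos r_pos t_bounds
    by (intro w_le) (simp_all add: ratio2_r[symmetric])
  then show "u * (1 - t) * w u \<le> r * (t - u)"
    using assms t_bounds by (simp add: pos_le_divide_eq mult_ac)
qed

lemma w_right:
  assumes "t \<le> u" "u < 1"
  shows "t * (1 - u) * w u \<le> r * (u - t)" "r * (u - t) \<le> u * (1 - t) * w u"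
proof -
  have u: "0 < u" using assms t_bounds by simp
  have "w u \<le> r * (u - t) / (t * (1 - u))"
  proof (rule w_le)
    have "(r * (t - u) / (t * (1 - u)))\<^sup>2 = (r * (u - t) / (t * (1 - u)))\<^sup>2"
      by (simp add: power_divide power_mult_distrib power2_commute)
    then show "2 * real n * kl t u \<le> (r * (u - t) / (t * (1 - u)))\<^sup>2"
      using mult_left_mono[OF kl_le_ratio1[OF t_bounds(1) assms], of "2 * real n"] n_pos
      by (simp only: ratio1_r)
  qed (use u assms r_pos t_bounds in auto)
  then show "t * (1 - u) * w u \<le> r * (u - t)"
    using assms t_bounds by (simp add: pos_le_divide_eq mult_ac)
  have "r * (u - t) / ((1 - t) * u) \<le> w u"
  proof (rule le_w)
    have "(r * (t - u) / ((1 - t) * u))\<^sup>2 = (r * (u - t) / ((1 - t) * u))\<^sup>2"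
      by (simp add: power_divide power_mult_distrib power2_commute)
    then show "(r * (u - t) / ((1 - t) * u))\<^sup>2 \<le> 2 * real n * kl t u"
      using mult_left_mono[OF kl_ge_ratio2[OF t_bounds(1) assms], of "2 * real n"] n_pos
      by (simp only: ratio2_r)
  qed (use u assms in auto)
  then show "r * (u - t) \<le> u * (1 - t) * w u"
    using u t_bounds by (simp add: pos_divide_le_eq mult_ac)
qed

text \<open>The derivatives of \<open>P\<close>, of \<open>L r T(w)\<close> and of \<open>L e\<close> share the positive factor \<open>weight\<close>.\<close>

definition weight :: "real \<Rightarrow> real" where
  "weight u = L * e u * real n / (u * (1 - u))"

lemma weight_pos: "0 < u \<Longrightarrow> u < 1 \<Longrightarrow> 0 < weight u"
  using L_pos n_pos by (simp add: weight_def e_def)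

lemma kl_deriv': "0 < u \<Longrightarrow> u < 1 \<Longrightarrow> (kl t has_real_derivative (u - t) / (u * (1 - u))) (at u)"
  by (rule kl_deriv[OF t_bounds])

lemma e_deriv:
  assumes "0 < u" "u < 1"
  shows "((\<lambda>u. L * e u) has_real_derivative weight u * (t - u)) (at u)"
proof -
  have "((\<lambda>u. L * e u) has_real_derivative L * (exp (- real n * kl t u) * (- real n * ((u - t) / (u * (1 - u)))))) (at u)"
    unfolding e_def by (intro DERIV_cmult DERIV_fun_exp kl_deriv' assms)
  also have "L * (exp (- real n * kl t u) * (- real n * ((u - t) / (u * (1 - u))))) = weight u * (t - u)"
    by (simp add: weight_def e_def minus_divide_left algebra_simps)
  finally show ?thesis .
qed

lemma gauss_deriv:
  assumes "0 < u" "u < 1" "u \<noteq> t"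
  shows "((\<lambda>u. L * r * gauss_tail (w u)) has_real_derivative weight u * (r * (t - u) / w u)) (at u)"
proof -
  have pos: "0 < 2 * real n * kl t u"
    using assms t_bounds n_pos kl_pos[of t u] by simp
  have "(w has_real_derivative (inverse (w u) / 2) * (2 * real n * ((u - t) / (u * (1 - u))))) (at u)"
    unfolding w_def
    by (rule DERIV_chain2[OF DERIV_real_sqrt[OF pos] DERIV_cmult[OF kl_deriv'[OF assms(1,2)]]])
  from DERIV_cmult[OF gauss_tail_deriv[OF this], of "L * r"]
  have "((\<lambda>u. L * r * gauss_tail (w u)) has_real_derivative
      L * r * (- e u * ((inverse (w u) / 2) * (2 * real n * ((u - t) / (u * (1 - u))))))) (at u)"
    by (simp only: exp_w[OF assms(1,2)])
  also have "L * r * (- e u * ((inverse (w u) / 2) * (2 * real n * ((u - t) / (u * (1 - u)))))) =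
      weight u * (r * (t - u) / w u)"
  proof -
    have "l * r * (- E * ((inverse v / 2) * (2 * N * (- d / D)))) = l * E * N / D * (r * d / v)"
      for l r E v N d D :: real
      by (simp add: field_simps)
    from this[of L r "e u" "w u" "real n" "t - u" "u * (1 - u)"] show ?thesis
      by (simp only: weight_def minus_diff_eq)
  qed
  finally show ?thesis .
qed

text \<open>\<open>L * e u\<close> is exactly the mass of Bin(n,u) at m: the entropy is the
  exponential rate of its change from parameter t to u.\<close>

lemma P_deriv:
  assumes "0 < u" "u < 1"
  shows "(P has_real_derivative weight u * (t * (1 - u))) (at u)"
proof -
  have "e u = exp (real m * ln (u / t) + real (n - m) * ln ((1 - u) / (1 - t)))"
    unfolding e_def kl_def nt using assms t_bounds
    by (simp add: nt(1)[symmetric] ln_div algebra_simps)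
  also have "\<dots> = (u / t) ^ m * ((1 - u) / (1 - t)) ^ (n - m)"
    using assms t_bounds by (simp add: exp_add exp_of_nat_mult)
  finally have "L * e u = real (n choose m) * u ^ m * (1 - u) ^ (n - m)"
    using t_bounds by (simp add: L_def power_divide)
  moreover have "u ^ m = u * u ^ (m - 1)"
    using m_pos by (cases m) auto
  moreover have "weight u * (t * (1 - u)) = (L * e u) * real m / u"
    using assms by (simp add: weight_def nt(1)[symmetric])
  ultimately have "real m * real (n choose m) * u ^ (m - 1) * (1 - u) ^ (n - m) = weight u * (t * (1 - u))"
    using assms by simp
  with binomial_tail_deriv[of m n u] m_pos m_less show ?thesis
    unfolding P_def[abs_def] by simp
qed

lemma P_0: "P 0 = 0"
  using m_pos by (auto simp: P_def intro!: sum.neutral)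

lemma P_1: "P 1 = 1"
proof -
  have "P 1 = (\<Sum>k=m..n. if k = n then 1 else 0)"
    unfolding P_def by (intro sum.cong) auto
  then show ?thesis using m_less by simp
qed

lemma P_cont: "isCont P u"
  unfolding P_def[abs_def] by (intro continuous_intros)

lemma kl_cont: "0 < u \<Longrightarrow> u < 1 \<Longrightarrow> isCont (kl t) u"
  by (rule DERIV_isCont[OF kl_deriv'])

lemma gauss_cont:
  assumes "0 < u" "u < 1"
  shows "isCont (\<lambda>u. gauss_tail (w u)) u"
proof -
  have "isCont w u"
    unfolding w_def[abs_def] using kl_cont[OF assms] by (intro continuous_intros)
  moreover have "isCont gauss_tail (w u)"
    using gauss_tail_deriv[OF DERIV_ident] by (rule DERIV_isCont)
  ultimately show ?thesis by (rule isCont_o2)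
qed

lemma e_cont: "0 < u \<Longrightarrow> u < 1 \<Longrightarrow> isCont e u"
  unfolding e_def[abs_def] using kl_cont by (intro continuous_intros)

lemma limits:
  assumes "filterlim (kl t) at_top F"
  shows "((\<lambda>u. gauss_tail (w u)) \<longlongrightarrow> 0) F" "(e \<longlongrightarrow> 0) F"
proof -
  have "filterlim (\<lambda>u. 2 * real n * kl t u) at_top F"
    using n_pos by (intro filterlim_tendsto_pos_mult_at_top[OF tendsto_const _ assms]) simp
  then have "filterlim w at_top F"
    unfolding w_def[abs_def] by (rule filterlim_compose[OF sqrt_at_top])
  then show "((\<lambda>u. gauss_tail (w u)) \<longlongrightarrow> 0) F"
    by (rule filterlim_compose[OF gauss_tail_tendsto_0])
  have "filterlim (\<lambda>u. real n * kl t u) at_top F"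
    using n_pos by (intro filterlim_tendsto_pos_mult_at_top[OF tendsto_const _ assms])
  then have "filterlim (\<lambda>u. - real n * kl t u) at_bot F"
    by (simp add: filterlim_uminus_at_top)
  then show "(e \<longlongrightarrow> 0) F"
    unfolding e_def[abs_def] by (rule filterlim_compose[OF exp_at_bot])
qed

lemmas limits_0 = limits[OF kl_at_right_0[OF t_bounds]]
lemmas limits_1 = limits[OF kl_at_left_1[OF t_bounds]]

lemma tendsto_P_0: "(P \<longlongrightarrow> 0) (at_right 0)"
  using P_cont[of 0] P_0 by (simp add: isCont_def filterlim_at_split)

lemma tendsto_P_1: "(P \<longlongrightarrow> 1) (at_left 1)"
  using P_cont[of 1] P_1 by (simp add: isCont_def filterlim_at_split)

lemma P_ge:
  assumes "0 < x" "x \<le> t"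
  shows "L * r * gauss_tail (w x) \<le> P x"
proof -
  let ?F = "\<lambda>u. P u - L * r * gauss_tail (w u)"
  have "0 \<le> ?F x"
  proof (rule nonneg_if_increasing_from_0[OF assms(1)])
    show "continuous_on {0<..x} ?F"
      using assms t_bounds P_cont gauss_cont
      by (intro continuous_at_imp_continuous_on ballI continuous_intros) auto
    have "(?F \<longlongrightarrow> 0 - L * r * 0) (at_right 0)"
      by (intro tendsto_intros tendsto_P_0 limits_0)
    then show "(?F \<longlongrightarrow> 0) (at_right 0)" by simp
    fix u assume u: "0 < u" "u < x"
    then have b: "u < 1" "u \<noteq> t" "u \<le> t" using assms t_bounds by auto
    have "r * (t - u) / w u \<le> t * (1 - u)"
      using w_left(1)[OF u(1) b(3)] w_pos[OF u(1) b(1,2)] by (simp add: pos_divide_le_eq)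
    from mult_left_mono[OF this, of "weight u"]
    have "0 \<le> weight u * (t * (1 - u)) - weight u * (r * (t - u) / w u)"
      using weight_pos[OF u(1) b(1)] by linarith
    with DERIV_diff[OF P_deriv[OF u(1) b(1)] gauss_deriv[OF u(1) b(1,2)]]
    show "\<exists>y. (?F has_real_derivative y) (at u) \<and> 0 \<le> y" by (intro exI conjI)
  qed
  then show ?thesis by simp
qed

lemma P_le:
  assumes "0 < x" "x \<le> t"
  shows "P x \<le> L * r * gauss_tail (w x) + L * e x"
proof -
  let ?F = "\<lambda>u. (L * r * gauss_tail (w u) + L * e u) - P u"
  have "0 \<le> ?F x"
  proof (rule nonneg_if_increasing_from_0[OF assms(1)])
    show "continuous_on {0<..x} ?F"
      using assms t_bounds P_cont gauss_cont e_cont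
      by (intro continuous_at_imp_continuous_on ballI continuous_intros) auto
    have "(?F \<longlongrightarrow> (L * r * 0 + L * 0) - 0) (at_right 0)"
      by (intro tendsto_intros tendsto_P_0 limits_0)
    then show "(?F \<longlongrightarrow> 0) (at_right 0)" by simp
    fix u assume u: "0 < u" "u < x"
    then have b: "u < 1" "u \<noteq> t" "u \<le> t" using assms t_bounds by auto
    have "u * (1 - t) \<le> r * (t - u) / w u"
      using w_left(2)[OF u(1) b(3)] w_pos[OF u(1) b(1,2)] by (simp add: pos_le_divide_eq)
    \<comment> \<open>Split t (1 - u) = u (1 - t) + (t - u): the first part is covered by the
      Gaussian derivative, the second is the derivative of \<open>L * e\<close>.\<close>
    then have "weight u * (t * (1 - u)) \<le> weight u * (r * (t - u) / w u + (t - u))"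
      using weight_pos[OF u(1) b(1)] by (intro mult_left_mono) (auto simp: algebra_simps)
    then have "0 \<le> (weight u * (r * (t - u) / w u) + weight u * (t - u)) - weight u * (t * (1 - u))"
      by (simp add: distrib_left)
    with DERIV_diff[OF DERIV_add[OF gauss_deriv[OF u(1) b(1,2)] e_deriv[OF u(1) b(1)]] P_deriv[OF u(1) b(1)]]
    show "\<exists>y. (?F has_real_derivative y) (at u) \<and> 0 \<le> y" by (intro exI conjI)
  qed
  then show ?thesis by simp
qed

text \<open>Right of t the quotient bounds on w reverse, so for 1 - P the Gaussian term alone is the
  upper bound and the correction \<open>L * e\<close> appears in the lower bound
  \<open>P_compl_ge\<close>.\<close>

lemma P_compl_le:
  assumes "t \<le> x" "x < 1"
  shows "1 - P x \<le> L * r * gauss_tail (w x)"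
proof -
  let ?F = "\<lambda>u. L * r * gauss_tail (w u) - (1 - P u)"
  have "0 \<le> ?F x"
  proof (rule nonneg_if_decreasing_to_0[OF assms(2)])
    show "continuous_on {x..<1} ?F"
      using assms t_bounds P_cont gauss_cont
      by (intro continuous_at_imp_continuous_on ballI continuous_intros) auto
    have "(?F \<longlongrightarrow> L * r * 0 - (1 - 1)) (at_left 1)"
      by (intro tendsto_intros tendsto_P_1 limits_1)
    then show "(?F \<longlongrightarrow> 0) (at_left 1)" by simp
    fix u assume u: "x < u" "u < 1"
    then have b: "0 < u" "u \<noteq> t" "t \<le> u" using assms t_bounds by auto
    have "t * (1 - u) \<le> r * (u - t) / w u"
      using w_right(1)[OF b(3) u(2)] w_pos[OF b(1) u(2) b(2)] by (simp add: pos_le_divide_eq)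
    then have "weight u * (r * (t - u) / w u + t * (1 - u)) \<le> weight u * 0"
      using weight_pos[OF b(1) u(2)] by (intro mult_left_mono) (auto simp: diff_divide_distrib algebra_simps)
    then have "weight u * (r * (t - u) / w u) - (0 - weight u * (t * (1 - u))) \<le> 0"
      by (simp add: distrib_left)
    with DERIV_diff[OF gauss_deriv[OF b(1) u(2) b(2)] DERIV_diff[OF DERIV_const P_deriv[OF b(1) u(2)], of 1]]
    show "\<exists>y. (?F has_real_derivative y) (at u) \<and> y \<le> 0" by (intro exI conjI)
  qed
  then show ?thesis by simp
qed

lemma P_compl_ge:
  assumes "t \<le> x" "x < 1"
  shows "L * r * gauss_tail (w x) - L * e x \<le> 1 - P x"
proof -
  let ?F = "\<lambda>u. (1 - P u) - (L * r * gauss_tail (w u) - L * e u)"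
  have "0 \<le> ?F x"
  proof (rule nonneg_if_decreasing_to_0[OF assms(2)])
    show "continuous_on {x..<1} ?F"
      using assms t_bounds P_cont gauss_cont e_cont
      by (intro continuous_at_imp_continuous_on ballI continuous_intros) auto
    have "(?F \<longlongrightarrow> (1 - 1) - (L * r * 0 - L * 0)) (at_left 1)"
      by (intro tendsto_intros tendsto_P_1 limits_1)
    then show "(?F \<longlongrightarrow> 0) (at_left 1)" by simp
    fix u assume u: "x < u" "u < 1"
    then have b: "0 < u" "u \<noteq> t" "t \<le> u" using assms t_bounds by auto
    have "r * (u - t) / w u \<le> u * (1 - t)"
      using w_right(2)[OF b(3) u(2)] w_pos[OF b(1) u(2) b(2)] by (simp add: pos_divide_le_eq)
    then have "weight u * ((t - u) - r * (t - u) / w u - t * (1 - u)) \<le> weight u * 0"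
      using weight_pos[OF b(1) u(2)] by (intro mult_left_mono) (auto simp: diff_divide_distrib algebra_simps)
    then have "(0 - weight u * (t * (1 - u))) - (weight u * (r * (t - u) / w u) - weight u * (t - u)) \<le> 0"
      by (simp add: right_diff_distrib)
    with DERIV_diff[OF DERIV_diff[OF DERIV_const P_deriv[OF b(1) u(2)], of 1] DERIV_diff[OF gauss_deriv[OF b(1) u(2) b(2)] e_deriv[OF b(1) u(2)]]]
    show "\<exists>y. (?F has_real_derivative y) (at u) \<and> y \<le> 0" by (intro exI conjI)
  qed
  then show ?thesis by simp
qed

subsection \<open>The equation for the Gaussian coordinate\<close>

text \<open>The same quantity \<open>L * r * gauss_tail 0\<close> lies below P(t) and above 1 -
  P(t).\<close>

lemma P_self_ge_half: "1 / 2 \<le> P t"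
  using P_ge[of t] P_compl_le[of t] t_bounds by simp

text \<open>P(t) and 1 - P(t) add up to 1, and twice the tail at 0 is sqrt (2 pi). In each sum only
  one of the two bounds carries a correction L, whence 1 / r.\<close>

lemma central_mass_bounds:
  "1 \<le> L * r * (sqrt (2 * pi) + 1 / r)" "L * r * (sqrt (2 * pi) - 1 / r) \<le> 1"
proof -
  have "sqrt (2 * pi) = sqrt (4 * (pi / 2))" by simp
  also have "\<dots> = 2 * sqrt (pi / 2)" by (subst real_sqrt_mult) simp
  finally have two: "sqrt (2 * pi) = 2 * gauss_tail 0" by (simp add: gauss_tail_0)
  have "1 \<le> 2 * (L * r * gauss_tail 0) + L" "2 * (L * r * gauss_tail 0) - L \<le> 1"
    using P_ge[of t] P_le[of t] P_compl_le[of t] P_compl_ge[of t] t_bounds by (simp_all add: w_self)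
  moreover have "L * r * (sqrt (2 * pi) + 1 / r) = 2 * (L * r * gauss_tail 0) + L"
    "L * r * (sqrt (2 * pi) - 1 / r) = 2 * (L * r * gauss_tail 0) - L"
    using r_pos unfolding two by (simp_all add: algebra_simps)
  ultimately show "1 \<le> L * r * (sqrt (2 * pi) + 1 / r)" "L * r * (sqrt (2 * pi) - 1 / r) \<le> 1"
    by simp_all
qed

lemma sqrt_2pi_ge: "5 / 2 \<le> sqrt (2 * pi)"
  using pi_gt3 pi_approx by (intro real_le_rsqrt) (simp add: power2_eq_square)

lemma ln_central_mass_ge: "- (1 / (2 * r)) \<le> ln (L * r) + ln (2 * pi) / 2"
proof -
  let ?s = "sqrt (2 * pi)"
  have s: "0 < ?s" by simp
  have k: "0 < L * r" using L_pos r_pos by simp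
  have "1 \<le> (L * r * ?s) * (1 + 1 / (r * ?s))"
    using central_mass_bounds(1) s r_pos by (simp add: algebra_simps)
  then have "0 \<le> ln ((L * r * ?s) * (1 + 1 / (r * ?s)))" by simp
  also have "\<dots> = ln (L * r * ?s) + ln (1 + 1 / (r * ?s))"
    using k s r_pos by (intro ln_mult_pos) (auto intro!: add_pos_pos)
  also have "ln (1 + 1 / (r * ?s)) \<le> 1 / (r * ?s)"
    using s r_pos by (intro ln_add_one_self_le_self) simp
  also have "1 / (r * ?s) \<le> 1 / (2 * r)"
    using sqrt_2pi_ge r_pos by (intro divide_left_mono) auto
  also have "ln (L * r * ?s) = ln (L * r) + ln (2 * pi) / 2"
    using k s by (simp add: ln_mult_pos ln_sqrt)
  finally show ?thesis by simp
qed

text \<open>For r >= 4 the factor sqrt (2 pi) - 1 / r is at least 2, so L r <= 1/2; then ln z <= z -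
  1 suffices.\<close>

lemma ln_central_mass_le:
  assumes "4 \<le> r"
  shows "ln (L * r) + ln (2 * pi) / 2 \<le> 1 / (2 * r)"
proof -
  let ?s = "sqrt (2 * pi)"
  have s: "0 < ?s" by simp
  have k: "0 < L * r" using L_pos r_pos by simp
  have "1 / r \<le> 1 / 4" using assms by (intro divide_left_mono) auto
  then have d: "2 \<le> ?s - 1 / r" using sqrt_2pi_ge by simp
  have "ln (L * r) + ln (2 * pi) / 2 = ln (L * r * ?s)"
    using k s by (simp add: ln_mult_pos ln_sqrt)
  also have "\<dots> \<le> L * r * ?s - 1"
    using k s by (intro ln_le_minus_one) simp
  also have "\<dots> \<le> L * r * (1 / r)"
    using central_mass_bounds(2) by (simp add: right_diff_distrib)
  also have "L * r \<le> 1 / 2"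
  proof -
    have "L * r * 2 \<le> L * r * (?s - 1 / r)" using d k by (intro mult_left_mono) auto
    then show ?thesis using central_mass_bounds(2) by simp
  qed
  then have "L * r * (1 / r) \<le> 1 / 2 * (1 / r)" using r_pos by (intro mult_right_mono) auto
  finally show ?thesis by simp
qed

lemma qfun_w_ge:
  assumes "0 < x" "x \<le> t"
  shows "- ln (P x) - 1 / (2 * r) \<le> qfun (w x)"
proof -
  have k: "0 < L * r" using L_pos r_pos by simp
  have "ln (L * r) + ln (gauss_tail (w x)) = ln (L * r * gauss_tail (w x))"
    using k gauss_tail_pos by (simp add: ln_mult_pos)
  also have "\<dots> \<le> ln (P x)"
    using P_ge[OF assms] k gauss_tail_pos[of "w x"] by (intro ln_mono) auto
  finally show ?thesis
    using ln_central_mass_ge by (simp add: qfun_eq)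
qed

text \<open>Of the error w + 3/2, the part w + 1 comes from the Mills bound on the correction
  \<open>L * e\<close>, and 1/2 from the central mass.\<close>

lemma qfun_w_le:
  assumes "0 < x" "x \<le> t" "4 \<le> r" "0 < P x"
  shows "qfun (w x) \<le> - ln (P x) + (w x + 3 / 2) / r"
proof -
  have x: "x < 1" using assms t_bounds by simp
  have k: "0 < L * r" using L_pos r_pos by simp
  have w0: "0 \<le> w x" using w_nonneg assms x by simp
  note T = gauss_tail_pos[of "w x"]
  have "L * e x \<le> L * ((w x + 1) * gauss_tail (w x))"
    using gauss_tail_mills[OF w0] exp_w[OF assms(1) x] L_pos by (intro mult_left_mono) auto
  then have "P x \<le> L * r * gauss_tail (w x) + L * ((w x + 1) * gauss_tail (w x))"
    using P_le[OF assms(1,2)] by simp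
  also have "\<dots> = L * r * gauss_tail (w x) * (1 + (w x + 1) / r)"
    using r_pos by (simp add: field_simps)
  finally have "ln (P x) \<le> ln (L * r * gauss_tail (w x) * (1 + (w x + 1) / r))"
    using assms(4) by (intro ln_mono)
  also have "\<dots> = ln (L * r) + ln (gauss_tail (w x)) + ln (1 + (w x + 1) / r)"
    using k T w0 r_pos by (simp add: ln_mult_pos add_pos_nonneg)
  also have "ln (1 + (w x + 1) / r) \<le> (w x + 1) / r"
    using w0 r_pos by (intro ln_add_one_self_le_self) simp
  finally have "ln (P x) \<le> ln (L * r) + ln (gauss_tail (w x)) + (w x + 1) / r" by simp
  moreover have "(w x + 3 / 2) / r = (w x + 1) / r + 1 / (2 * r)"
    using r_pos by (simp add: field_simps)
  ultimately show ?thesis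
    using ln_central_mass_le[OF assms(3)] by (simp add: qfun_eq)
qed

text \<open>Bounding the Gaussian tail by sqrt (pi / 2) \<open>e\<close> leaves the prefactor L r
  (sqrt (pi / 2) + 1 / r). It is at most 1 by \<open>central_mass_bounds\<close>, since sqrt (2 pi)
  is twice sqrt (pi / 2) and sqrt (pi / 2) >= 2 / r.\<close>

lemma chernoff:
  assumes "0 < x" "x \<le> t" "4 \<le> r"
  shows "P x \<le> e x"
proof -
  have x: "x < 1" using assms t_bounds by simp
  have k: "0 < L * r" using L_pos r_pos by simp
  have w0: "0 \<le> w x" using w_nonneg assms x by simp
  have "1 / r \<le> 1 / 4" using assms by (intro divide_left_mono) auto
  moreover have "1 \<le> sqrt (pi / 2)" using pi_gt3 by simp
  moreover have "sqrt (2 * pi) = sqrt (4 * (pi / 2))" by simp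
  then have "sqrt (2 * pi) = 2 * sqrt (pi / 2)" by (subst (asm) real_sqrt_mult) simp
  ultimately have "sqrt (pi / 2) + 1 / r \<le> sqrt (2 * pi) - 1 / r" by linarith
  then have "L * r * (sqrt (pi / 2) + 1 / r) \<le> L * r * (sqrt (2 * pi) - 1 / r)"
    using k by (intro mult_left_mono) auto
  then have mass: "L * r * (sqrt (pi / 2) + 1 / r) \<le> 1"
    using central_mass_bounds(2) by linarith
  have "P x \<le> L * r * (sqrt (pi / 2) * e x) + L * e x"
    using P_le[OF assms(1,2)] gauss_tail_le_exp[OF w0] exp_w[OF assms(1) x] k
      mult_left_mono[of "gauss_tail (w x)" "sqrt (pi / 2) * e x" "L * r"] by auto
  also have "\<dots> = L * r * (sqrt (pi / 2) + 1 / r) * e x"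
    using r_pos by (simp add: algebra_simps)
  also have "\<dots> \<le> 1 * e x"
    using mass by (intro mult_right_mono) (auto simp: e_def)
  finally show ?thesis by simp
qed

section \<open>From the Gaussian coordinate back to gamma\<close>

text \<open>\<open>g\<close> is gamma, as \<open>sigma_hat\<close> equals r / n. The quadratic
  bounds on \<open>kl\<close> with variances v + (t - x) and v - (t - x) give relative errors (t -
  x) / v, which is g / r.\<close>

lemma w_vs_gamma:
  assumes "0 < x" "x \<le> t" "(t - x) \<le> t * (1 - t) / 4"
  defines "g \<equiv> (t - x) * real n / r"
  shows "g\<^sup>2 \<le> (w x)\<^sup>2 * (1 + g / r)" "(w x)\<^sup>2 * (1 - g / r) \<le> g\<^sup>2" "g / r \<le> 1 / 4"
proof -
  have x: "x < 1" using assms t_bounds by simp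
  define v where "v = t * (1 - t)"
  have v: "0 < v" using t_bounds by (simp add: v_def)
  have r2: "r\<^sup>2 = real n * v" by (simp add: r_sq v_def)
  have "g / r = (t - x) * real n / r\<^sup>2" by (simp add: g_def power2_eq_square)
  then have y: "g / r = (t - x) / v" using n_pos by (simp add: r2)
  have g2: "g\<^sup>2 = real n * (t - x)\<^sup>2 / v"
    using n_pos by (simp add: g_def power_divide power_mult_distrib r2 power2_eq_square[of "real n"])
  have ex: "(t - x) / v \<le> 1 / 4"
    using assms(3) v by (simp add: v_def[symmetric] field_simps)
  then show "g / r \<le> 1 / 4" by (simp add: y)
  \<comment> \<open>The variance is Lipschitz with constant 1 on the unit interval.\<close>
  have diff: "u * (1 - u) \<le> v + (t - x)" "v - (t - x) \<le> u * (1 - u)"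
    if "u \<in> closed_segment x t" for u
  proof -
    have u: "x \<le> u" "u \<le> t" using that assms by (auto simp: closed_segment_eq_real_ivl)
    have eq: "u * (1 - u) - v = (t - u) * (u + t - 1)" by (simp add: v_def algebra_simps)
    have "\<bar>(t - u) * (u + t - 1)\<bar> \<le> (t - x) * 1"
      unfolding abs_mult using u assms t_bounds by (intro mult_mono) auto
    with eq have "\<bar>u * (1 - u) - v\<bar> \<le> t - x" by simp
    then show "u * (1 - u) \<le> v + (t - x)" "v - (t - x) \<le> u * (1 - u)"
      unfolding abs_le_iff by simp_all
  qed
  have M: "0 < v + (t - x)" "0 < v - (t - x)"
    using v assms(2,3) by (auto simp: v_def[symmetric])
  have "(t - x)\<^sup>2 / (2 * (v + (t - x))) \<le> kl t x"
    using kl_ge_quadratic[OF t_bounds assms(1) x M(1) diff(1)] .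
  then have "(t - x)\<^sup>2 \<le> 2 * kl t x * (v + (t - x))"
    using M by (simp add: pos_divide_le_eq algebra_simps)
  from mult_left_mono[OF this, of "real n / v"]
  have "g\<^sup>2 \<le> real n / v * (2 * kl t x * (v + (t - x)))" using v by (simp add: g2)
  also have "\<dots> = (w x)\<^sup>2 * (1 + g / r)"
    unfolding w_sq[OF assms(1) x] y using v by (simp add: field_simps)
  finally show "g\<^sup>2 \<le> (w x)\<^sup>2 * (1 + g / r)" .
  have "kl t x \<le> (t - x)\<^sup>2 / (2 * (v - (t - x)))"
    using kl_le_quadratic[OF t_bounds assms(1) x M(2) diff(2)] .
  then have "2 * kl t x * (v - (t - x)) \<le> (t - x)\<^sup>2"
    using M by (simp add: pos_le_divide_eq algebra_simps)
  from mult_left_mono[OF this, of "real n / v"]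
  have "real n / v * (2 * kl t x * (v - (t - x))) \<le> g\<^sup>2" using v by (simp add: g2)
  moreover have "real n / v * (2 * kl t x * (v - (t - x))) = (w x)\<^sup>2 * (1 - g / r)"
    unfolding w_sq[OF assms(1) x] y using v by (simp add: field_simps)
  ultimately show "(w x)\<^sup>2 * (1 - g / r) \<le> g\<^sup>2" by simp
qed

lemma PX_eq: "PX n t u = P u"
proof -
  have "{k. k \<le> n \<and> real n * t \<le> real k} = {m..n}" by (auto simp: nt)
  then show ?thesis by (simp add: PX_def P_def)
qed

end

text \<open>Used with y = g / r, Z = alpha / r^2 and d the half-width of the last factor. It takes
  square roots: sqrt (1 + y) <= 1 + y / 2 and, for y <= 1/4, sqrt (1 - y) >= 1 - 9 y / 16. The slope
  9/16 fits because (9/16)^2 * 5/2 = 405/512 < 4/5.\<close>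

lemma linear_bounds_of_square_bounds:
  fixes W g y d Z :: real
  assumes "0 \<le> W" "0 \<le> g" "0 \<le> y" "y \<le> 1 / 4" "0 \<le> d"
    and "d\<^sup>2 = 4 / 5 * Z" "y\<^sup>2 \<le> 5 / 2 * Z"
    and "g\<^sup>2 \<le> W\<^sup>2 * (1 + y)" "W\<^sup>2 * (1 - y) \<le> g\<^sup>2"
  shows "g \<le> W * (1 + d)" "W * (1 - d) \<le> g"
proof -
  have Z: "0 \<le> Z" using assms(6) zero_le_power2[of d] by linarith
  have "(y / 2)\<^sup>2 \<le> d\<^sup>2" "(9 / 16 * y)\<^sup>2 \<le> d\<^sup>2"
    unfolding assms(6) using assms(7) Z by (simp_all add: power_mult_distrib power_divide)
  then have yd: "y / 2 \<le> d" "9 / 16 * y \<le> d"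
    using assms(5) power2_le_imp_le by blast+
  have "W\<^sup>2 * (1 + y) \<le> W\<^sup>2 * (1 + y / 2)\<^sup>2"
    by (intro mult_left_mono) (simp_all add: power2_sum power_divide)
  with assms(8) have "g\<^sup>2 \<le> (W * (1 + y / 2))\<^sup>2"
    by (simp add: power_mult_distrib)
  then have "g \<le> W * (1 + y / 2)"
    by (rule power2_le_imp_le) (use assms(1,3) in simp)
  also have "\<dots> \<le> W * (1 + d)" using assms(1) yd by (intro mult_left_mono) auto
  finally show "g \<le> W * (1 + d)" .
  have "y * y \<le> y * (1 / 4)" using assms(3,4) by (intro mult_left_mono)
  then have "(1 - 9 / 16 * y)\<^sup>2 \<le> 1 - y"
    using assms(3) by (simp add: power2_eq_square algebra_simps)
  then have "W\<^sup>2 * (1 - 9 / 16 * y)\<^sup>2 \<le> W\<^sup>2 * (1 - y)"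
    by (intro mult_left_mono) auto
  with assms(9) have "(W * (1 - 9 / 16 * y))\<^sup>2 \<le> g\<^sup>2"
    by (simp add: power_mult_distrib)
  then have "W * (1 - 9 / 16 * y) \<le> g"
    by (rule power2_le_imp_le) (rule assms(2))
  moreover have "W * (1 - d) \<le> W * (1 - 9 / 16 * y)"
    using assms(1) yd by (intro mult_left_mono) auto
  ultimately show "W * (1 - d) \<le> g" by linarith
qed

section \<open>Numerical slack and inversion of q\<close>

text \<open>Here s is sqrt alpha. By sqrt 15 <= 4 and s^2 >= 16/25 the right side is at least 0.64 s
  + 2 s + 0.7; by sqrt 2 < 3/2 the left side is at most 1.5 s + 1.5.\<close>

lemma error_constants:
  fixes s W :: real
  assumes "4 / 5 \<le> s" "W\<^sup>2 \<le> 2 * s\<^sup>2"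
  shows "1 / 2 \<le> sqrt (pi / 6) + 8 * s / sqrt 15"
    and "W + 3 / 2 \<le> s\<^sup>2 * (64 * s / (15 * sqrt 15)) + (sqrt (pi / 6) + 8 * s / sqrt 15)"
proof -
  have c: "7 / 10 \<le> sqrt (pi / 6)"
    using pi_gt3 by (intro real_le_rsqrt) (simp add: power2_eq_square)
  have q: "sqrt 15 \<le> 4" by (intro real_le_lsqrt) auto
  have a: "2 * s \<le> 8 * s / sqrt 15"
    using assms mult_left_mono[OF q, of s] by (simp add: pos_le_divide_eq)
  then show "1 / 2 \<le> sqrt (pi / 6) + 8 * s / sqrt 15"
    using c assms by linarith
  have b: "s \<le> 64 * s / (15 * sqrt 15)"
    using assms mult_left_mono[OF q, of s] by (simp add: pos_le_divide_eq)
  have s2: "(4 / 5)\<^sup>2 \<le> s\<^sup>2" using assms by (intro power_mono) auto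
  have "W\<^sup>2 \<le> (3 / 2 * s)\<^sup>2"
  proof -
    have "(3 / 2 * s)\<^sup>2 = 9 / 4 * s\<^sup>2" by (simp add: power_mult_distrib power_divide)
    then show ?thesis using assms(2) zero_le_power2[of s] by linarith
  qed
  then have W: "W \<le> 3 / 2 * s"
    by (rule power2_le_imp_le) (use assms(1) in simp)
  have "(4 / 5)\<^sup>2 * s \<le> s\<^sup>2 * (64 * s / (15 * sqrt 15))"
    using s2 b assms by (intro mult_mono) auto
  then have "16 / 25 * s \<le> s\<^sup>2 * (64 * s / (15 * sqrt 15))"
    by (simp add: power2_eq_square)
  then show "W + 3 / 2 \<le> s\<^sup>2 * (64 * s / (15 * sqrt 15)) + (sqrt (pi / 6) + 8 * s / sqrt 15)"
    using W a c assms(1) by linarith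
qed

text \<open>Below ln 2 the truncation to 0 makes the bound trivial, so the lower endpoint needs no
  range condition on y.\<close>

lemma max0_qinv_le:
  assumes "y \<le> qfun W" "0 \<le> W"
  shows "0 \<le> max0_qinv y" "max0_qinv y \<le> W"
proof -
  show "0 \<le> max0_qinv y"
    using max0_qinv(1)[of y] by (cases "ln 2 < y") (auto simp: max0_qinv_def)
  show "max0_qinv y \<le> W"
  proof (cases "ln 2 < y")
    case True
    then have "qfun (max0_qinv y) \<le> qfun W" using max0_qinv(2) assms by simp
    then show ?thesis using strict_mono_less_eq[OF qfun_strict_mono] by simp
  qed (use assms in \<open>simp add: max0_qinv_def\<close>)
qed

lemma le_max0_qinv:
  assumes "qfun W \<le> y" "ln 2 < y"
  shows "W \<le> max0_qinv y"
  using assms max0_qinv(2)[of y] strict_mono_less_eq[OF qfun_strict_mono, of W "max0_qinv y"] by simp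

text \<open>Positivity of the tail is asserted along with the equation, so that the logarithm is a
  genuine one.\<close>

theorem mainTheorem13:
  fixes n :: nat and \<theta> \<alpha> :: real
  assumes "n \<ge> 1" and "0 < \<theta>" and "\<theta> < 1"
    and "\<exists>m::nat. real n * \<theta> = real m"
    and "ln 2 < \<alpha>" and "\<alpha> \<le> real n * \<theta>\<^sup>2 * (1 - \<theta>)\<^sup>2 / 8"
  shows "let r = sqrt (real n * \<theta> * (1 - \<theta>));
             c1 = 64 * sqrt \<alpha> / (15 * sqrt 15);
             c2 = sqrt (pi / 6) + 8 * sqrt \<alpha> / sqrt 15;
             c3 = 2 * sqrt \<alpha> / sqrt 5
         in \<exists>\<gamma>. 0 < PX n \<theta> (phi n \<gamma> \<theta>) \<and> - ln (PX n \<theta> (phi n \<gamma> \<theta>)) = \<alpha>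
              \<and> max0_qinv (\<alpha> * (1 - c1 / r) - c2 / r) * (1 - c3 / r) \<le> \<gamma>
              \<and> \<gamma> \<le> max0_qinv (\<alpha> * (1 + c1 / r) + c2 / r) * (1 + c3 / r)"
proof -
  obtain m :: nat where m: "real n * \<theta> = real m" using assms(4) by auto
  have n: "0 < real n" using assms(1) by simp
  have "0 < real m" using m n assms(2) by (metis mult_pos_pos)
  moreover have "real m < real n" using m n assms(3) mult_strict_left_mono[of \<theta> 1 "real n"] by simp
  ultimately interpret binomial_tail n m by unfold_locales auto
  have t: "t = \<theta>" using m n by (simp add: t_def field_simps)
  have v: "0 < \<theta> * (1 - \<theta>)" using assms by simp
  have r_eq: "sqrt (real n * \<theta> * (1 - \<theta>)) = r" by (simp add: r_def t)
  define s where "s = sqrt \<alpha>"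
  have ln2: "(2::real) / 3 \<le> ln 2" by (rule ln2_ge_two_thirds)
  have \<alpha>: "2 / 3 < \<alpha>" using ln2 assms(5) by linarith
  have s2: "s\<^sup>2 = \<alpha>" using \<alpha> by (simp add: s_def)
  have s45: "4 / 5 \<le> s"
    unfolding s_def using \<alpha> by (intro real_le_rsqrt) (simp add: power2_eq_square)
  \<comment> \<open>The upper bound on alpha is r^2 times theta (1 - theta) / 8, hence at most r^2 /
    32; with alpha > 2/3 this gives r^2 > 64/3.\<close>
  have r4: "4 \<le> r"
  proof -
    have "\<theta> * (1 - \<theta>) \<le> 1 / 4"
      using zero_le_power2[of "2 * \<theta> - 1"] by (simp add: power2_eq_square algebra_simps)
    then have "r\<^sup>2 * (\<theta> * (1 - \<theta>)) \<le> r\<^sup>2 * (1 / 4)" by (intro mult_left_mono) auto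
    moreover have "real n * \<theta>\<^sup>2 * (1 - \<theta>)\<^sup>2 = r\<^sup>2 * (\<theta> * (1 - \<theta>))"
      unfolding r_sq t by (simp add: power2_eq_square)
    ultimately have "4\<^sup>2 \<le> r\<^sup>2" using assms(6) \<alpha> by simp
    then show ?thesis by (rule power2_le_imp_le) (use r_pos in simp)
  qed
  have "exp (- \<alpha>) \<le> exp (- ln 2)" using assms(5) by simp
  also have "\<dots> = 1 / 2" by (simp add: exp_minus)
  finally have "exp (- \<alpha>) \<le> P t" using P_self_ge_half by linarith
  \<comment> \<open>The solution is found in the success probability x; gamma is recovered from
    it.\<close>
  then have "\<exists>x\<ge>0. x \<le> t \<and> P x = exp (- \<alpha>)"
    using t_bounds P_0 P_cont by (intro IVT) auto
  then obtain x where x0: "0 \<le> x" and xt: "x \<le> t" and Px: "P x = exp (- \<alpha>)" by auto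
  have x: "0 < x" using x0 Px P_0 by (cases "x = 0") auto
  have x1: "x < 1" using xt t_bounds by simp
  have P_pos: "0 < P x" and lnP: "- ln (P x) = \<alpha>" by (simp_all add: Px)
  have "exp (- \<alpha>) \<le> exp (- real n * kl t x)" using chernoff[OF x xt r4] by (simp add: Px e_def)
  then have kl: "real n * kl t x \<le> \<alpha>" by simp
  then have W2: "(w x)\<^sup>2 \<le> 2 * s\<^sup>2" by (simp add: w_sq[OF x x1] s2)
  \<comment> \<open>Pinsker and the Chernoff bound meet the upper bound on alpha: the constant 1/8
    there is 2 * (1/4)^2.\<close>
  have "real n * (2 * (t - x)\<^sup>2) \<le> real n * kl t x"
    using kl_pinsker[OF t_bounds x x1] n by (intro mult_left_mono) auto
  also have "\<dots> \<le> real n * (2 * (t * (1 - t) / 4)\<^sup>2)"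
    using kl assms(6) by (simp add: t power_mult_distrib power_divide)
  finally have "(t - x)\<^sup>2 \<le> (t * (1 - t) / 4)\<^sup>2" using n by simp
  then have dev: "t - x \<le> t * (1 - t) / 4"
    by (rule power2_le_imp_le) (use v in \<open>simp add: t\<close>)
  define g where "g = (t - x) * real n / r"
  note wg = w_vs_gamma[OF x xt dev, folded g_def]
  have g0: "0 \<le> g" using xt r_pos by (simp add: g_def)
  have W0: "0 \<le> w x" using w_nonneg x x1 by simp
  define d where "d = 2 * s / sqrt 5 / r"
  have d2: "d\<^sup>2 = 4 / 5 * (\<alpha> / r\<^sup>2)"
    by (simp add: d_def power_divide power_mult_distrib s2)
  have d0: "0 \<le> d" using s45 r_pos by (simp add: d_def)
  \<comment> \<open>With w^2 <= 2 alpha and g / r <= 1/4, this is the source of the factor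
    5/2.\<close>
  have "(w x)\<^sup>2 * (1 + g / r) \<le> (2 * s\<^sup>2) * (5 / 4)"
    using W2 wg(3) g0 r_pos by (intro mult_mono) auto
  then have "g\<^sup>2 \<le> 5 / 2 * \<alpha>" using wg(1) unfolding s2 by linarith
  from divide_right_mono[OF this, of "r\<^sup>2"]
  have y2: "(g / r)\<^sup>2 \<le> 5 / 2 * (\<alpha> / r\<^sup>2)"
    by (simp add: power_divide)
  have lin: "g \<le> w x * (1 + d)" "w x * (1 - d) \<le> g"
    using linear_bounds_of_square_bounds[OF W0 g0 _ wg(3) d0 d2 y2 wg(1,2)] g0 r_pos by auto
  define c1 where "c1 = 64 * s / (15 * sqrt 15)"
  define c2 where "c2 = sqrt (pi / 6) + 8 * s / sqrt 15"
  note err = error_constants[OF s45 W2, folded c1_def c2_def, unfolded s2]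
  have c1: "0 \<le> c1" using s45 by (simp add: c1_def)
  have "qfun (w x) \<le> \<alpha> + (w x + 3 / 2) / r"
    using qfun_w_le[OF x xt r4 P_pos] lnP by simp
  also have "(w x + 3 / 2) / r \<le> (\<alpha> * c1 + c2) / r"
    using err(2) r_pos by (simp add: divide_right_mono)
  also have "\<alpha> + (\<alpha> * c1 + c2) / r = \<alpha> * (1 + c1 / r) + c2 / r"
    by (simp add: field_simps add_divide_distrib)
  finally have q_upper: "qfun (w x) \<le> \<alpha> * (1 + c1 / r) + c2 / r" by simp
  have "\<alpha> * (1 - c1 / r) - c2 / r = \<alpha> - (\<alpha> * c1 + c2) / r"
    by (simp add: algebra_simps add_divide_distrib)
  moreover have "(1 / 2) / r \<le> (\<alpha> * c1 + c2) / r"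
    using err(1) c1 \<alpha> r_pos by (intro divide_right_mono) (auto intro: add_increasing)
  ultimately have q_lower: "\<alpha> * (1 - c1 / r) - c2 / r \<le> qfun (w x)"
    using qfun_w_ge[OF x xt] lnP by simp
  \<comment> \<open>Ensures that the upper endpoint lies in the range where \<open>max0_qinv\<close>
    really inverts q.\<close>
  have y_gt: "ln 2 < \<alpha> * (1 + c1 / r) + c2 / r"
  proof -
    have "0 \<le> \<alpha> * (c1 / r)" "0 \<le> c2 / r" using c1 \<alpha> r_pos err(1) by auto
    then show ?thesis using assms(5) by (simp add: distrib_left)
  qed
  have upper: "g \<le> max0_qinv (\<alpha> * (1 + c1 / r) + c2 / r) * (1 + d)"
    using lin(1) mult_right_mono[OF le_max0_qinv[OF q_upper y_gt], of "1 + d"] d0 by linarith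
  have lower: "max0_qinv (\<alpha> * (1 - c1 / r) - c2 / r) * (1 - d) \<le> g"
  proof (cases "d \<le> 1")
    case True
    then show ?thesis
      using lin(2) mult_right_mono[OF max0_qinv_le(2)[OF q_lower W0], of "1 - d"] by linarith
  next
    \<comment> \<open>The factor 1 - d is negative, so multiplying by it would reverse the
      comparison; but then the lower bound is nonpositive and g >= 0 suffices.\<close>
    case False
    then show ?thesis
      using mult_nonneg_nonpos[OF max0_qinv_le(1)[OF q_lower W0], of "1 - d"] g0 by linarith
  qed
  have "sigma_hat n \<theta> = r / real n"
  proof -
    have "\<theta> * (1 - \<theta>) / real n = real n * \<theta> * (1 - \<theta>) / (real n)\<^sup>2"
      using n by (simp add: power2_eq_square)
    then show ?thesis by (simp add: sigma_hat_def r_eq real_sqrt_divide)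
  qed
  then have "phi n g \<theta> = x" using n r_pos by (simp add: phi_def g_def t)
  then have PX: "PX n \<theta> (phi n g \<theta>) = P x" using PX_eq[of x] by (simp add: t)
  show ?thesis
    unfolding Let_def r_eq s_def[symmetric] c1_def[symmetric] c2_def[symmetric] d_def[symmetric]
    using upper lower PX P_pos lnP by (intro exI[of _ g]) auto
qed

end
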